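(* Let $X$ and $Y$ be finite topological spaces, let $F:X\longrightarrow P(Y)$ be a multifunction, and let $x\in X$. Then: (i) $F$ is upper semicontinuous at $x$ if and only if $F(U_x)\subset\bigcup_{y\in F(x)}U_y$. (ii) $F$ is lower semicontinuous at $x$ if and only if $F(x')\cap U_y\neq\emptyset$ for all $x'\in U_x$ and all $y\in F(x)$.
   Context: For a point $p$ of a finite topological space, $U_p$ denotes the intersection of all open sets containing $p$, i.e. the smallest open set containing $p$ (in the relevant space). $P(Y)$ is the collection of all subsets of $Y$; a multifunction is a function $F:X\to P(Y)$; for $U\subseteq X$, $F(U)=\bigcup_{u\in U}F(u)\subseteq Y$. $F$ is upper semicontinuous at $x_0\in X$ if for every open set $V$ in $Y$ with $F(x_0)\subset V$ there exists an open set $U$ containing $x_0$ such that $F(U)\subset V$. $F$ is lower semicontinuous at $x_0\in X$ if for every open set $V$ in $Y$ with $F(x_0)\cap V\neq\emptyset$ there exists an open set $U$ containing $x_0$ such that $F(x)\cap V\neq\emptyset$ for each $x\in U$. The symbol $\subset$ allows equality. *)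

theory Defs
  imports "HOL-Analysis.Abstract_Topology"
begin

(* Meaningful only for p \<in> topspace X; otherwise the intersection is empty-indexed, i.e. UNIV. *)
definition min_open :: "'a topology \<Rightarrow> 'a \<Rightarrow> 'a set"
  where "min_open X p = \<Inter> {U. openin X U \<and> p \<in> U}"

(* A multifunction F : X \<rightarrow> P(Y) need only take values in subsets of Y at points of X; empty
   values are allowed.  For a set U of points, F(U) is written \<Union>(F ` U). *)
definition multifunction :: "'a topology \<Rightarrow> 'b topology \<Rightarrow> ('a \<Rightarrow> 'b set) \<Rightarrow> bool"
  where "multifunction X Y F \<longleftrightarrow> F \<in> topspace X \<rightarrow> Pow (topspace Y)"

definition upper_semicontinuous_at ::
    "'a topology \<Rightarrow> 'b topology \<Rightarrow> ('a \<Rightarrow> 'b set) \<Rightarrow> 'a \<Rightarrow> bool"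
  where "upper_semicontinuous_at X Y F x0 \<longleftrightarrow>
    (\<forall>V. openin Y V \<and> F x0 \<subseteq> V \<longrightarrow> (\<exists>U. openin X U \<and> x0 \<in> U \<and> \<Union>(F ` U) \<subseteq> V))"

definition lower_semicontinuous_at ::
    "'a topology \<Rightarrow> 'b topology \<Rightarrow> ('a \<Rightarrow> 'b set) \<Rightarrow> 'a \<Rightarrow> bool"
  where "lower_semicontinuous_at X Y F x0 \<longleftrightarrow>
    (\<forall>V. openin Y V \<and> F x0 \<inter> V \<noteq> {} \<longrightarrow>
      (\<exists>U. openin X U \<and> x0 \<in> U \<and> (\<forall>x\<in>U. F x \<inter> V \<noteq> {})))"

end

theory Submission
  imports Defs
begin

text \<open>In a finite space \<open>min_open X p\<close> is itself open, hence the least open set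
  around \<open>p\<close>. Both conditions on the neighbourhood U of x pass to smaller sets, so U
  may be taken to be \<open>min_open X x\<close>. The quantifier over V collapses as well. The union
  of the sets \<open>min_open Y y\<close> for y in \<open>F x\<close> is the least open set
  containing \<open>F x\<close>, so it decides the upper case. An open V meeting \<open>F x\<close>
  contains some \<open>min_open Y y\<close> with y in \<open>F x\<close>, so these sets decide the
  lower case.\<close>

text \<open>A finite carrier has only finitely many open subsets, so the intersection is finite; the
  whole space contains \<open>p\<close>, so the family is nonempty.\<close>

lemma openin_min_open:
  assumes "finite (topspace X)" and "p \<in> topspace X"
  shows "openin X (min_open X p)"
  unfolding min_open_def
proof (rule openin_Inter)
  have "{U. openin X U \<and> p \<in> U} \<subseteq> Pow (topspace X)"
    by (auto dest: openin_subset)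
  then show "finite {U. openin X U \<and> p \<in> U}"
    using assms(1) by (meson finite_Pow_iff finite_subset)
  show "{U. openin X U \<and> p \<in> U} \<noteq> {}"
    using assms(2) by auto
qed auto

lemma mem_min_open: "p \<in> min_open X p"
  by (simp add: min_open_def)

lemma min_open_subset: "openin X U \<Longrightarrow> p \<in> U \<Longrightarrow> min_open X p \<subseteq> U"
  by (auto simp: min_open_def)

text \<open>Forward, semicontinuity is applied to V = \<open>?W\<close>; backward, every admissible
  V contains \<open>?W\<close>.\<close>

lemma upper_semicontinuous_at_iff_min_open:
  assumes "finite (topspace X)" and "x \<in> topspace X"
    and "finite (topspace Y)" and "F x \<subseteq> topspace Y"
  shows "upper_semicontinuous_at X Y F x \<longleftrightarrow>
    \<Union>(F ` min_open X x) \<subseteq> (\<Union>y\<in>F x. min_open Y y)" (is "_ \<longleftrightarrow> _ \<subseteq> ?W")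
proof
  assume usc: "upper_semicontinuous_at X Y F x"
  have "openin Y ?W"
    using assms by (intro openin_Union) (auto intro: openin_min_open)
  moreover have "F x \<subseteq> ?W"
    by (auto intro: mem_min_open)
  ultimately obtain U where U: "openin X U" "x \<in> U" "\<Union>(F ` U) \<subseteq> ?W"
    using usc unfolding upper_semicontinuous_at_def by meson
  have "\<Union>(F ` min_open X x) \<subseteq> \<Union>(F ` U)"
    using min_open_subset[OF U(1,2)] by blast
  then show "\<Union>(F ` min_open X x) \<subseteq> ?W"
    using U(3) by (rule subset_trans)
next
  assume sub: "\<Union>(F ` min_open X x) \<subseteq> ?W"
  show "upper_semicontinuous_at X Y F x"
    unfolding upper_semicontinuous_at_def
  \<comment> \<open>\<open>exI\<close> leaves U schematic; the \<open>show\<close> below fixes it to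
    \<open>min_open X x\<close>, one choice serving every V.\<close>
  proof (intro allI impI exI conjI)
    fix V assume V: "openin Y V \<and> F x \<subseteq> V"
    then have "?W \<subseteq> V"
      using min_open_subset[of Y V] by blast
    with sub show "\<Union>(F ` min_open X x) \<subseteq> V"
      by (rule subset_trans)
  qed (auto intro: mem_min_open openin_min_open assms)
qed

text \<open>Forward, each \<open>min_open Y y\<close> serves as V, since it meets \<open>F x\<close>
  in y; backward, meeting \<open>min_open Y y\<close> forces meeting any larger V.\<close>

lemma lower_semicontinuous_at_iff_min_open:
  assumes "finite (topspace X)" and "x \<in> topspace X"
    and "finite (topspace Y)" and "F x \<subseteq> topspace Y"
  shows "lower_semicontinuous_at X Y F x \<longleftrightarrow>
    (\<forall>x'\<in>min_open X x. \<forall>y\<in>F x. F x' \<inter> min_open Y y \<noteq> {})"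
proof
  assume lsc: "lower_semicontinuous_at X Y F x"
  show "\<forall>x'\<in>min_open X x. \<forall>y\<in>F x. F x' \<inter> min_open Y y \<noteq> {}"
  proof (intro ballI)
    fix x' y assume x': "x' \<in> min_open X x" and y: "y \<in> F x"
    have "openin Y (min_open Y y)"
      using assms y by (auto intro: openin_min_open)
    moreover have "F x \<inter> min_open Y y \<noteq> {}"
      using y mem_min_open by fast
    ultimately obtain U where U: "openin X U" "x \<in> U" "\<forall>z\<in>U. F z \<inter> min_open Y y \<noteq> {}"
      using lsc unfolding lower_semicontinuous_at_def by meson
    show "F x' \<inter> min_open Y y \<noteq> {}"
      using U x' min_open_subset[OF U(1,2)] by blast
  qed
next
  assume meets: "\<forall>x'\<in>min_open X x. \<forall>y\<in>F x. F x' \<inter> min_open Y y \<noteq> {}"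
  show "lower_semicontinuous_at X Y F x"
    unfolding lower_semicontinuous_at_def
  \<comment> \<open>The schematic U is again \<open>min_open X x\<close>, fixed by the assumption on
    z.\<close>
  proof (intro allI impI exI conjI ballI)
    fix V z assume V: "openin Y V \<and> F x \<inter> V \<noteq> {}" and z: "z \<in> min_open X x"
    then obtain y where y: "y \<in> F x" "y \<in> V"
      by blast
    then have "min_open Y y \<subseteq> V"
      using V by (simp add: min_open_subset)
    then show "F z \<inter> V \<noteq> {}"
      using meets z y(1) by blast
  qed (auto intro: mem_min_open openin_min_open assms)
qed

theorem theorem7p6:
  fixes X :: "'a topology" and Y :: "'b topology" and F :: "'a \<Rightarrow> 'b set" and x :: 'a
  assumes "finite (topspace X)" and "finite (topspace Y)"
    and "multifunction X Y F"
    and "x \<in> topspace X"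
  shows "(upper_semicontinuous_at X Y F x \<longleftrightarrow>
            \<Union>(F ` min_open X x) \<subseteq> (\<Union>y\<in>F x. min_open Y y)) \<and>
         (lower_semicontinuous_at X Y F x \<longleftrightarrow>
            (\<forall>x'\<in>min_open X x. \<forall>y\<in>F x. F x' \<inter> min_open Y y \<noteq> {}))"
proof -
  have "F x \<subseteq> topspace Y"
    using assms(3,4) by (auto simp: multifunction_def)
  with assms show ?thesis
    by (intro conjI upper_semicontinuous_at_iff_min_open lower_semicontinuous_at_iff_min_open)
qed

end
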